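(* Let $1<p<2$ and let $\{\varepsilon_k:k\in\mathbb Z\}$ be independent and identically distributed real random variables such that $\operatorname E[|\varepsilon_0|^p\log(1+|\varepsilon_0|)]<\infty$ and $\operatorname E\varepsilon_0=0$. Let $\{\psi_j:j\in\mathbb Z\}\subset\mathbb R$ with $\psi_j=0$ for $j<0$ and $\sum_{j=0}^\infty|\psi_j|^p<\infty$. If there exists $q$ with $p<q\le2$ such that $$\frac{\mathcal W_n(q)}{\mathcal W_n(p)}=O(n^{1/q-1/p})\quad\text{as } n\to\infty,$$ then $$\sum_{n=1}^\infty n^{-1}\Pr\{|\mathcal W_n^{-1}(p)S_n|>\delta\}<\infty$$ for each $\delta>0$.
   Context: The linear process $\{X_k:k\in\mathbb Z\}$ is defined by the almost surely convergent series $X_k=\sum_{j=0}^\infty\psi_j\varepsilon_{k-j}$, and $S_n=\sum_{k=1}^nX_k$ for $n\ge1$. For $n\ge1$ and $j\in\mathbb Z$, $w_{nj}=\sum_{k=1}^n\psi_{k-j}$ (with the convention $\psi_i=0$ for $i<0$), and for $r\ge1$, $$\mathcal W_n(r)=\Bigl(\sum_{j=-\infty}^n|w_{nj}|^r\Bigr)^{1/r},$$ which is finite when $\sum_j|\psi_j|^r<\infty$. $\mathcal W_n^{-1}(p)$ denotes $1/\mathcal W_n(p)$. *)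

theory Defs
  imports "HOL-Probability.Probability" "HOL-Library.Landau_Symbols"
begin

(* suminf is unspecified at sample points where the series diverges; under the hypotheses
   psi in l^p and E |eps_0|^p < infinity, E eps_0 = 0 with 1 < p < 2 this is a null set. *)
definition linear_process :: "(int \<Rightarrow> real) \<Rightarrow> (int \<Rightarrow> 'a \<Rightarrow> real) \<Rightarrow> int \<Rightarrow> 'a \<Rightarrow> real" where
  "linear_process \<psi> \<epsilon> k \<omega> = (\<Sum>j. \<psi> (int j) * \<epsilon> (k - int j) \<omega>)"

definition partial_sum :: "(int \<Rightarrow> real) \<Rightarrow> (int \<Rightarrow> 'a \<Rightarrow> real) \<Rightarrow> nat \<Rightarrow> 'a \<Rightarrow> real" where
  "partial_sum \<psi> \<epsilon> n \<omega> = (\<Sum>k=1..n. linear_process \<psi> \<epsilon> (int k) \<omega>)"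

definition weight :: "(int \<Rightarrow> real) \<Rightarrow> nat \<Rightarrow> int \<Rightarrow> real" where
  "weight \<psi> n j = (\<Sum>k=1..n. \<psi> (int k - j))"

(* infsum is 0 on non-summable families, but the family below is summable whenever psi
   vanishes on the negative integers and is in l^r, in particular for r >= p if psi is in l^p. *)
definition weight_norm :: "(int \<Rightarrow> real) \<Rightarrow> nat \<Rightarrow> real \<Rightarrow> real" where
  "weight_norm \<psi> n r = (\<Sum>\<^sub>\<infinity>j\<in>{..int n}. \<bar>weight \<psi> n j\<bar> powr r) powr (1 / r)"

end

theory Submission
  imports Defs
begin

text \<open>
  Write \<open>g\<close> for \<open>min_abs_sq\<close>. For independent centred \<open>Y\<^sub>i\<close>, cutting each variable at height \<open>1\<close>,
  applying Kolmogorov's maximal inequality to the bounded parts and Markov's inequality to the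
  remainders bounds the probability that some partial sum exceeds \<open>\<delta>\<close> by a constant times
  \<open>\<Sum>i. E (g Y\<^sub>i)\<close> (\<open>truncated_maximal_inequality_infinite\<close>). This single inequality is used twice.

  Applied to tails of a series, it gives almost sure convergence as soon as \<open>\<Sum>i. E (g Y\<^sub>i)\<close> is finite
  (\<open>independent_series_converges\<close>). Since \<open>g y \<le> \<bar>y\<bar> powr p\<close>, the series that defines the linear process
  converges almost surely, and interchanging it with the finite sum over time shows
  \<open>S\<^sub>n = (\<Sum>m. weight \<psi> n (n - m) * \<epsilon> (n - m))\<close> almost surely
  (\<open>partial_sum_eq_weighted_series\<close>).

  Applied to this series divided by \<open>W\<^sub>n(p)\<close>, it bounds \<open>P\<^sub>n\<close>, the probability in the theorem. The
  normalised weights have \<open>p\<close>-th powers summing to at most \<open>1\<close>, and by the growth hypothesis, for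
  large \<open>n\<close>, \<open>q\<close>-th powers summing to at most a constant \<open>C\<close> times \<open>n powr (1 - q / p)\<close>. As \<open>g y\<close> is at most both
  \<open>\<bar>y\<bar> powr p\<close> and \<open>\<bar>y\<bar> powr q\<close>, the probability \<open>P\<^sub>n\<close> is at most a constant times the expectation of
  \<open>min (\<bar>\<epsilon>\<^sub>0\<bar> powr p) (C * n powr (1 - q / p) * \<bar>\<epsilon>\<^sub>0\<bar> powr q)\<close> (\<open>normalized_partial_sum_tail\<close>).

  It remains to sum these expectations with weights \<open>1 / n\<close>, which can be done pointwise. With
  \<open>t = \<bar>\<epsilon>\<^sub>0\<bar> powr p\<close>, the indices \<open>n \<le> t\<close> contribute \<open>t\<close> times a harmonic sum, hence about \<open>t * ln t\<close>,
  and the indices \<open>n > t\<close> contribute a convergent tail of order \<open>t\<close>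
  (\<open>sum_min_powr_le_log_moment\<close>). The logarithmic moment makes the sum integrable.
\<close>

section \<open>Kolmogorov's maximal inequality\<close>

text \<open>
  The partial sums of \<open>x\<close>, frozen from the first time they leave \<open>[-\<delta>, \<delta>]\<close>. Writing the stopped sum as
  a recursion keeps stopping times out of the proof: whether the next summand is added depends
  only on the earlier ones.
\<close>
primrec stopped_sum :: "real \<Rightarrow> (nat \<Rightarrow> real) \<Rightarrow> nat \<Rightarrow> real" where
  "stopped_sum \<delta> x 0 = 0"
| "stopped_sum \<delta> x (Suc k) =
     (if \<bar>stopped_sum \<delta> x k\<bar> > \<delta> then stopped_sum \<delta> x k else stopped_sum \<delta> x k + x k)"

lemma stopped_sum_cong:
  "(\<And>i. i < k \<Longrightarrow> x i = y i) \<Longrightarrow> stopped_sum \<delta> x k = stopped_sum \<delta> y k"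
  by (induction k) auto

lemma stopped_sum_detects_crossing:
  assumes "\<exists>k\<le>n. \<bar>\<Sum>i<k. x i\<bar> > \<delta>"
  shows "\<bar>stopped_sum \<delta> x n\<bar> > \<delta>"
proof -
  have "\<bar>stopped_sum \<delta> x n\<bar> > \<delta> \<or>
      (stopped_sum \<delta> x n = (\<Sum>i<n. x i) \<and> (\<forall>k\<le>n. \<bar>\<Sum>i<k. x i\<bar> \<le> \<delta>))"
  proof (induction n)
    case 0
    show ?case by auto
  next
    case (Suc n)
    then show ?case by (auto simp: le_Suc_eq not_less)
  qed
  then show ?thesis
    using assms by fastforce
qed

lemma measurable_stopped_sum:
  "k \<le> n \<Longrightarrow> (\<lambda>x. stopped_sum \<delta> x k) \<in> borel_measurable (PiM {..<n} (\<lambda>_. borel))"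
proof (induction k)
  case (Suc k)
  then have [measurable]: "(\<lambda>x. stopped_sum \<delta> x k) \<in> borel_measurable (PiM {..<n} (\<lambda>_. borel))"
    and [measurable]: "(\<lambda>x. x k) \<in> borel_measurable (PiM {..<n} (\<lambda>_. borel))"
    by auto
  then show ?case by simp
qed simp

lemma measurable_stopped_sum_compose [measurable (raw)]:
  assumes [measurable]: "\<And>i. X i \<in> borel_measurable M"
  shows "(\<lambda>\<omega>. stopped_sum \<delta> (\<lambda>i. X i \<omega>) k) \<in> borel_measurable M"
  by (induction k) simp_all

context prob_space
begin

lemma indep_sets_reindex:
  assumes "inj_on f I" and ind: "indep_sets F (f ` I)"
  shows "indep_sets (\<lambda>i. F (f i)) I"
  unfolding indep_sets_def
proof (intro conjI ballI allI impI)
  show "F (f i) \<subseteq> events" if "i \<in> I" for i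
    using ind that by (auto simp: indep_sets_def)
next
  fix J A assume J: "J \<subseteq> I" "J \<noteq> {}" "finite J" and A: "A \<in> Pi J (\<lambda>i. F (f i))"
  have inj: "inj_on f J" using assms(1) J(1) by (rule inj_on_subset)
  define B where "B = A \<circ> the_inv_into J f"
  have B: "B (f j) = A j" if "j \<in> J" for j
    using that inj by (simp add: B_def the_inv_into_f_f)
  have "prob (\<Inter>k\<in>f ` J. B k) = (\<Prod>k\<in>f ` J. prob (B k))"
    by (rule indep_setsD[OF ind]) (use J A B in auto)
  moreover have "(\<Inter>k\<in>f ` J. B k) = (\<Inter>j\<in>J. A j)"
    using B by auto
  moreover have "(\<Prod>k\<in>f ` J. prob (B k)) = (\<Prod>j\<in>J. prob (A j))"
    using B by (simp add: prod.reindex[OF inj])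
  ultimately show "prob (\<Inter>j\<in>J. A j) = (\<Prod>j\<in>J. prob (A j))" by simp
qed

lemma indep_vars_reindex:
  assumes "inj_on f I" and "indep_vars N X (f ` I)"
  shows "indep_vars (\<lambda>i. N (f i)) (\<lambda>i. X (f i)) I"
  using assms(2)
    indep_sets_reindex[OF assms(1), of "\<lambda>i. {X i -` A \<inter> space M |A. A \<in> sets (N i)}"]
  by (simp add: indep_vars_def2)

text \<open>
  The step from \<open>n\<close> to \<open>n + 1\<close> adds \<open>A * X n\<close>, where \<open>A\<close> indicates that the sum has not yet left
  \<open>[-\<delta>, \<delta>]\<close>. The cross term in the square has expectation zero, because \<open>A\<close> and the stopped sum
  are functions of the variables before \<open>X n\<close>.
\<close>
lemma stopped_sum_second_moment:
  fixes X :: "nat \<Rightarrow> 'a \<Rightarrow> real" and \<delta> :: real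
  assumes ind: "indep_vars (\<lambda>_. borel) X UNIV"
    and sq: "\<And>i. integrable M (\<lambda>\<omega>. (X i \<omega>)\<^sup>2)"
    and mean: "\<And>i. expectation (X i) = 0"
  defines "T \<equiv> \<lambda>k \<omega>. stopped_sum \<delta> (\<lambda>i. X i \<omega>) k"
  shows "integrable M (\<lambda>\<omega>. (T n \<omega>)\<^sup>2) \<and>
    expectation (\<lambda>\<omega>. (T n \<omega>)\<^sup>2) \<le> (\<Sum>i<n. expectation (\<lambda>\<omega>. (X i \<omega>)\<^sup>2))"
proof (induction n)
  case 0
  then show ?case by (simp add: T_def)
next
  case (Suc n)
  have rv [measurable]: "X i \<in> borel_measurable M" for i
    using ind by (auto simp: indep_vars_def)
  have T_rv [measurable]: "T k \<in> borel_measurable M" for k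
    unfolding T_def by measurable
  have IH: "integrable M (\<lambda>\<omega>. (T n \<omega>)\<^sup>2)"
    "expectation (\<lambda>\<omega>. (T n \<omega>)\<^sup>2) \<le> (\<Sum>i<n. expectation (\<lambda>\<omega>. (X i \<omega>)\<^sup>2))"
    using Suc by auto
  have X_int: "integrable M (X n)"
    by (rule square_integrable_imp_integrable) (use sq in auto)
  define A where "A \<omega> = (if \<bar>T n \<omega>\<bar> > \<delta> then 0 else 1::real)" for \<omega>
  define R where "R \<omega> = T n \<omega> * A \<omega>" for \<omega>
  have A_rv [measurable]: "A \<in> borel_measurable M" and R_rv [measurable]: "R \<in> borel_measurable M"
    unfolding A_def R_def by measurable
  have T_int: "integrable M (T n)"
    by (rule square_integrable_imp_integrable) (use IH in auto)
  have R_int: "integrable M R"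
    by (rule Bochner_Integration.integrable_bound[OF T_int]) (auto simp: R_def A_def)
  \<comment> \<open>\<open>F\<close> exhibits \<open>R\<close> as a function of \<open>X 0, \<dots>, X (n - 1)\<close> alone.\<close>
  define F where "F x = (if \<bar>stopped_sum \<delta> x n\<bar> > \<delta> then 0 else stopped_sum \<delta> x n)" for x
  have F_rv: "F \<in> borel_measurable (PiM {..<n} (\<lambda>_. borel))"
    using measurable_stopped_sum[OF order_refl, measurable] unfolding F_def by measurable
  have "indep_var borel (F \<circ> (\<lambda>\<omega>. restrict (\<lambda>i. X i \<omega>) {..<n}))
      borel ((\<lambda>x. x n) \<circ> (\<lambda>\<omega>. restrict (\<lambda>i. X i \<omega>) {n}))"
    by (intro indep_var_compose[OF indep_var_restrict[OF ind]] F_rv) auto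
  also have "F \<circ> (\<lambda>\<omega>. restrict (\<lambda>i. X i \<omega>) {..<n}) = R"
  proof
    fix \<omega>
    have "stopped_sum \<delta> (restrict (\<lambda>i. X i \<omega>) {..<n}) n = T n \<omega>"
      unfolding T_def by (rule stopped_sum_cong) simp
    then show "(F \<circ> (\<lambda>\<omega>. restrict (\<lambda>i. X i \<omega>) {..<n})) \<omega> = R \<omega>"
      by (simp add: F_def R_def A_def)
  qed
  also have "(\<lambda>x. x n) \<circ> (\<lambda>\<omega>. restrict (\<lambda>i. X i \<omega>) {n}) = X n"
    by auto
  finally have RX: "indep_var borel R borel (X n)" .
  have RX_int: "integrable M (\<lambda>\<omega>. R \<omega> * X n \<omega>)"
    by (rule indep_var_integrable[OF RX R_int X_int])
  have RX_0: "expectation (\<lambda>\<omega>. R \<omega> * X n \<omega>) = 0"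
    using indep_var_lebesgue_integral[OF RX R_int X_int] mean by simp
  have AX_int: "integrable M (\<lambda>\<omega>. A \<omega> * (X n \<omega>)\<^sup>2)"
    by (rule Bochner_Integration.integrable_bound[OF sq[of n]]) (auto simp: A_def)
  have split: "(T (Suc n) \<omega>)\<^sup>2 = (T n \<omega>)\<^sup>2 + 2 * (R \<omega> * X n \<omega>) + A \<omega> * (X n \<omega>)\<^sup>2" for \<omega>
    by (auto simp: T_def R_def A_def power2_eq_square algebra_simps)
  have "expectation (\<lambda>\<omega>. (T (Suc n) \<omega>)\<^sup>2)
      = expectation (\<lambda>\<omega>. (T n \<omega>)\<^sup>2) + expectation (\<lambda>\<omega>. A \<omega> * (X n \<omega>)\<^sup>2)"
    unfolding split using IH RX_int RX_0 AX_int by simp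
  also have "expectation (\<lambda>\<omega>. A \<omega> * (X n \<omega>)\<^sup>2) \<le> expectation (\<lambda>\<omega>. (X n \<omega>)\<^sup>2)"
    by (rule integral_mono[OF AX_int sq]) (auto simp: A_def)
  finally have "expectation (\<lambda>\<omega>. (T (Suc n) \<omega>)\<^sup>2)
      \<le> (\<Sum>i<Suc n. expectation (\<lambda>\<omega>. (X i \<omega>)\<^sup>2))"
    using IH by simp
  moreover have "integrable M (\<lambda>\<omega>. (T (Suc n) \<omega>)\<^sup>2)"
    unfolding split using IH RX_int AX_int by simp
  ultimately show ?case by blast
qed

text \<open>
  If some partial sum leaves \<open>[-\<delta>, \<delta>]\<close>, the stopped sum is still outside at time \<open>n\<close>, so Chebyshev's
  inequality for this one variable suffices.
\<close>
theorem Kolmogorov_maximal_inequality: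
  fixes X :: "nat \<Rightarrow> 'a \<Rightarrow> real"
  assumes ind: "indep_vars (\<lambda>_. borel) X UNIV"
    and sq: "\<And>i. integrable M (\<lambda>\<omega>. (X i \<omega>)\<^sup>2)"
    and mean: "\<And>i. expectation (X i) = 0"
    and "\<delta> > 0"
  shows "prob {\<omega> \<in> space M. \<exists>k\<le>n. \<bar>\<Sum>i<k. X i \<omega>\<bar> > \<delta>}
    \<le> (\<Sum>i<n. expectation (\<lambda>\<omega>. (X i \<omega>)\<^sup>2)) / \<delta>\<^sup>2"
proof -
  have rv [measurable]: "X i \<in> borel_measurable M" for i
    using ind by (auto simp: indep_vars_def)
  let ?T = "\<lambda>\<omega>. stopped_sum \<delta> (\<lambda>i. X i \<omega>) n"
  have T: "integrable M (\<lambda>\<omega>. (?T \<omega>)\<^sup>2)"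
    "expectation (\<lambda>\<omega>. (?T \<omega>)\<^sup>2) \<le> (\<Sum>i<n. expectation (\<lambda>\<omega>. (X i \<omega>)\<^sup>2))"
    using stopped_sum_second_moment[OF ind sq mean] by auto
  have "{\<omega> \<in> space M. \<exists>k\<le>n. \<bar>\<Sum>i<k. X i \<omega>\<bar> > \<delta>} \<subseteq> {\<omega> \<in> space M. \<bar>?T \<omega>\<bar> > \<delta>}"
    using stopped_sum_detects_crossing by blast
  also have "\<dots> \<subseteq> {\<omega> \<in> space M. (?T \<omega>)\<^sup>2 \<ge> \<delta>\<^sup>2}"
    using \<open>\<delta> > 0\<close> by (auto simp: power2_le_iff_abs_le abs_le_square_iff[symmetric])
  finally have "prob {\<omega> \<in> space M. \<exists>k\<le>n. \<bar>\<Sum>i<k. X i \<omega>\<bar> > \<delta>}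
      \<le> prob {\<omega> \<in> space M. (?T \<omega>)\<^sup>2 \<ge> \<delta>\<^sup>2}"
    by (intro finite_measure_mono) auto
  also have "\<dots> \<le> expectation (\<lambda>\<omega>. (?T \<omega>)\<^sup>2) / \<delta>\<^sup>2"
    using \<open>\<delta> > 0\<close> T by (intro integral_Markov_inequality_measure[where A = "{}"]) auto
  also have "\<dots> \<le> (\<Sum>i<n. expectation (\<lambda>\<omega>. (X i \<omega>)\<^sup>2)) / \<delta>\<^sup>2"
    using T by (intro divide_right_mono) auto
  finally show ?thesis .
qed

end

section \<open>A maximal inequality without second moments\<close>

text \<open>
  This is the quantity controlled by truncation at height \<open>1\<close>: a second moment below the cut and
  a first moment above it.
\<close>
definition min_abs_sq :: "real \<Rightarrow> real" where
  "min_abs_sq y = min \<bar>y\<bar> (y\<^sup>2)"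

lemma min_abs_sq_nonneg [simp]: "0 \<le> min_abs_sq y"
  by (simp add: min_abs_sq_def)

lemma min_abs_sq_le_abs: "min_abs_sq y \<le> \<bar>y\<bar>"
  by (simp add: min_abs_sq_def)

lemma min_abs_sq_measurable [measurable]: "min_abs_sq \<in> borel_measurable borel"
  unfolding min_abs_sq_def by measurable

lemma min_abs_sq_eq: "min_abs_sq y = (if \<bar>y\<bar> \<le> 1 then y\<^sup>2 else \<bar>y\<bar>)"
proof -
  have "y\<^sup>2 = \<bar>y\<bar> * \<bar>y\<bar>" by (simp add: power2_eq_square)
  moreover have "\<bar>y\<bar> * \<bar>y\<bar> \<le> \<bar>y\<bar> * 1" if "\<bar>y\<bar> \<le> 1"
    using that by (intro mult_left_mono) auto
  moreover have "\<bar>y\<bar> * 1 \<le> \<bar>y\<bar> * \<bar>y\<bar>" if "\<not> \<bar>y\<bar> \<le> 1"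
    using that by (intro mult_left_mono) auto
  ultimately show ?thesis
    by (auto simp: min_abs_sq_def)
qed

lemma min_abs_sq_le_powr:
  assumes "1 \<le> r" "r \<le> 2"
  shows "min_abs_sq y \<le> \<bar>y\<bar> powr r"
proof (cases "y = 0")
  case False
  show ?thesis
  proof (cases "\<bar>y\<bar> \<le> 1")
    case True
    then have "y\<^sup>2 = \<bar>y\<bar> powr 2"
      using False by (simp add: powr_numeral)
    also have "\<dots> \<le> \<bar>y\<bar> powr r"
      using True False assms by (intro powr_mono') auto
    finally show ?thesis using True by (simp add: min_abs_sq_eq)
  next
    case big: False
    then have "\<bar>y\<bar> powr 1 \<le> \<bar>y\<bar> powr r"
      using assms by (intro powr_mono) auto
    then show ?thesis using big by (simp add: min_abs_sq_eq)
  qed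
qed (simp add: min_abs_sq_def)

context prob_space
begin

text \<open>
  Each \<open>Y i\<close> is a bounded part \<open>X i\<close> plus a remainder \<open>Z i\<close>, both centred. Each of them is
  allowed half of \<open>\<delta>\<close>. The sum of the \<open>\<bar>Z i\<bar>\<close> already dominates all partial sums of the remainders,
  so no maximal inequality is needed for them; centring them at most doubles their first absolute
  moment, which is why both terms of the constant carry a \<open>4\<close>.
\<close>
lemma truncated_maximal_inequality:
  fixes Y :: "nat \<Rightarrow> 'a \<Rightarrow> real"
  assumes ind: "indep_vars (\<lambda>_. borel) Y UNIV"
    and int: "\<And>i. integrable M (Y i)"
    and mean: "\<And>i. expectation (Y i) = 0"
    and \<delta>: "\<delta> > 0"
  shows "prob {\<omega> \<in> space M. \<exists>k\<le>n. \<bar>\<Sum>i<k. Y i \<omega>\<bar> > \<delta>}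
    \<le> (4 / \<delta>\<^sup>2 + 4 / \<delta>) * (\<Sum>i<n. expectation (\<lambda>\<omega>. min_abs_sq (Y i \<omega>)))"
proof -
  have rv [measurable]: "Y i \<in> borel_measurable M" for i
    using ind by (auto simp: indep_vars_def)
  define u where "u y = (if \<bar>y\<bar> \<le> 1 then y else 0)" for y :: real
  have u_rv [measurable]: "u \<in> borel_measurable borel"
    unfolding u_def by measurable
  have u_bd: "\<bar>u y\<bar> \<le> 1" for y by (auto simp: u_def)
  define U where "U i \<omega> = u (Y i \<omega>)" for i \<omega>
  define V where "V i \<omega> = Y i \<omega> - U i \<omega>" for i \<omega>
  define X where "X i \<omega> = U i \<omega> - expectation (U i)" for i \<omega>
  define Z where "Z i \<omega> = V i \<omega> - expectation (V i)" for i \<omega>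
  let ?g = "\<lambda>i. expectation (\<lambda>\<omega>. min_abs_sq (Y i \<omega>))"
  have U_rv [measurable]: "U i \<in> borel_measurable M" for i
    unfolding U_def by measurable
  have U_int: "integrable M (U i)" for i
    by (rule integrable_const_bound[where B = 1]) (auto simp: U_def u_bd)
  have U2_int: "integrable M (\<lambda>\<omega>. (U i \<omega>)\<^sup>2)" for i
    by (rule integrable_const_bound[where B = 1])
       (auto simp: U_def u_bd power_le_one_iff abs_square_le_1)
  have V_int: "integrable M (V i)" for i
    unfolding V_def by (intro Bochner_Integration.integrable_diff int U_int)
  have X_rv [measurable]: "X i \<in> borel_measurable M" for i
    unfolding X_def by measurable
  have Z_int: "integrable M (Z i)" for i
    unfolding Z_def using V_int by simp
  have g_int: "integrable M (\<lambda>\<omega>. min_abs_sq (Y i \<omega>))" for i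
    by (rule Bochner_Integration.integrable_bound[OF int[of i]]) (auto simp: min_abs_sq_le_abs)
  have Y_split: "Y i \<omega> = X i \<omega> + Z i \<omega>" for i \<omega>
  proof -
    have "expectation (V i) = - expectation (U i)"
      unfolding V_def using Bochner_Integration.integral_diff[OF int U_int, of i i] mean by simp
    then show ?thesis by (simp add: X_def Z_def V_def)
  qed
  have X_mean: "expectation (X i) = 0" for i
    unfolding X_def using U_int by (simp add: prob_space)
  have X2: "(X i \<omega>)\<^sup>2 = (U i \<omega>)\<^sup>2 - 2 * expectation (U i) * U i \<omega> + (expectation (U i))\<^sup>2" for i \<omega>
    by (simp add: X_def power2_diff)
  have X2_int: "integrable M (\<lambda>\<omega>. (X i \<omega>)\<^sup>2)" for i
    unfolding X2 using U_int U2_int by simp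
  have X_var: "expectation (\<lambda>\<omega>. (X i \<omega>)\<^sup>2) \<le> ?g i" for i
  proof -
    have "expectation (\<lambda>\<omega>. (X i \<omega>)\<^sup>2) = expectation (\<lambda>\<omega>. (U i \<omega>)\<^sup>2) - (expectation (U i))\<^sup>2"
      unfolding X2 using U_int U2_int by (simp add: prob_space power2_eq_square)
    also have "\<dots> \<le> expectation (\<lambda>\<omega>. (U i \<omega>)\<^sup>2)" by simp
    also have "\<dots> \<le> ?g i"
      by (intro integral_mono U2_int g_int) (auto simp: U_def u_def min_abs_sq_eq)
    finally show ?thesis .
  qed
  have Z_abs: "expectation (\<lambda>\<omega>. \<bar>Z i \<omega>\<bar>) \<le> 2 * ?g i" for i
  proof -
    have "expectation (\<lambda>\<omega>. \<bar>Z i \<omega>\<bar>) \<le> expectation (\<lambda>\<omega>. \<bar>V i \<omega>\<bar> + \<bar>expectation (V i)\<bar>)"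
      using Z_int V_int by (intro integral_mono) (auto simp: Z_def)
    also have "\<dots> = expectation (\<lambda>\<omega>. \<bar>V i \<omega>\<bar>) + \<bar>expectation (V i)\<bar>"
      using V_int by (simp add: prob_space)
    also have "\<dots> \<le> 2 * expectation (\<lambda>\<omega>. \<bar>V i \<omega>\<bar>)"
      using integral_abs_bound[of M "V i"] by simp
    also have "expectation (\<lambda>\<omega>. \<bar>V i \<omega>\<bar>) \<le> ?g i"
      by (intro integral_mono g_int integrable_abs V_int)
         (auto simp: V_def U_def u_def min_abs_sq_eq)
    finally show ?thesis by simp
  qed
  have X_ind: "indep_vars (\<lambda>_. borel) X UNIV"
    unfolding X_def U_def
    by (rule indep_vars_compose2[OF ind]) simp
  define CX where "CX = {\<omega> \<in> space M. \<exists>k\<le>n. \<bar>\<Sum>i<k. X i \<omega>\<bar> > \<delta> / 2}"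
  define CZ where "CZ = {\<omega> \<in> space M. (\<Sum>i<n. \<bar>Z i \<omega>\<bar>) \<ge> \<delta> / 2}"
  have CX_prob: "prob CX \<le> (\<Sum>i<n. ?g i) * (4 / \<delta>\<^sup>2)"
  proof -
    have "prob CX \<le> (\<Sum>i<n. expectation (\<lambda>\<omega>. (X i \<omega>)\<^sup>2)) / (\<delta> / 2)\<^sup>2"
      unfolding CX_def using \<delta>
      by (intro Kolmogorov_maximal_inequality X_ind X2_int X_mean) simp
    also have "\<dots> \<le> (\<Sum>i<n. ?g i) / (\<delta> / 2)\<^sup>2"
      by (intro divide_right_mono sum_mono X_var) simp
    finally show ?thesis by (simp add: power_divide)
  qed
  have CZ_prob: "prob CZ \<le> (\<Sum>i<n. ?g i) * (4 / \<delta>)"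
  proof -
    have "prob CZ \<le> expectation (\<lambda>\<omega>. \<Sum>i<n. \<bar>Z i \<omega>\<bar>) / (\<delta> / 2)"
      unfolding CZ_def using \<delta> Z_int
      by (intro integral_Markov_inequality_measure[where A = "{}"]) (auto intro!: sum_nonneg)
    also have "expectation (\<lambda>\<omega>. \<Sum>i<n. \<bar>Z i \<omega>\<bar>) = (\<Sum>i<n. expectation (\<lambda>\<omega>. \<bar>Z i \<omega>\<bar>))"
      using Z_int by simp
    also have "\<dots> / (\<delta> / 2) \<le> (\<Sum>i<n. 2 * ?g i) / (\<delta> / 2)"
      using \<delta> by (intro divide_right_mono sum_mono Z_abs) simp
    also have "\<dots> = (\<Sum>i<n. ?g i) * (4 / \<delta>)"
      by (simp add: sum_distrib_left[symmetric])
    finally show ?thesis .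
  qed
  have CX_ev: "CX \<in> events" and CZ_ev: "CZ \<in> events"
    using Z_int unfolding CX_def CZ_def by measurable
  have "{\<omega> \<in> space M. \<exists>k\<le>n. \<bar>\<Sum>i<k. Y i \<omega>\<bar> > \<delta>} \<subseteq> CX \<union> CZ"
  proof
    fix \<omega> assume "\<omega> \<in> {\<omega> \<in> space M. \<exists>k\<le>n. \<bar>\<Sum>i<k. Y i \<omega>\<bar> > \<delta>}"
    then obtain k where k: "\<omega> \<in> space M" "k \<le> n" "\<bar>\<Sum>i<k. Y i \<omega>\<bar> > \<delta>" by auto
    have "(\<Sum>i<k. Y i \<omega>) = (\<Sum>i<k. X i \<omega>) + (\<Sum>i<k. Z i \<omega>)"
      by (simp add: Y_split sum.distrib)
    moreover have "\<bar>\<Sum>i<k. Z i \<omega>\<bar> \<le> (\<Sum>i<k. \<bar>Z i \<omega>\<bar>)" by (rule sum_abs)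
    moreover have "(\<Sum>i<k. \<bar>Z i \<omega>\<bar>) \<le> (\<Sum>i<n. \<bar>Z i \<omega>\<bar>)"
      using k by (intro sum_mono2) auto
    ultimately have "\<bar>\<Sum>i<k. X i \<omega>\<bar> > \<delta> / 2 \<or> (\<Sum>i<n. \<bar>Z i \<omega>\<bar>) \<ge> \<delta> / 2"
      using k by linarith
    then show "\<omega> \<in> CX \<union> CZ"
      using k by (auto simp: CX_def CZ_def)
  qed
  then have "prob {\<omega> \<in> space M. \<exists>k\<le>n. \<bar>\<Sum>i<k. Y i \<omega>\<bar> > \<delta>} \<le> prob (CX \<union> CZ)"
    using CX_ev CZ_ev by (intro finite_measure_mono) auto
  also have "\<dots> \<le> prob CX + prob CZ"
    using CX_ev CZ_ev by (rule measure_Un_le)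
  also have "\<dots> \<le> (4 / \<delta>\<^sup>2 + 4 / \<delta>) * (\<Sum>i<n. ?g i)"
    using CX_prob CZ_prob by (simp add: algebra_simps)
  finally show ?thesis .
qed

text \<open>The bound is uniform in the number of summands, so continuity from below removes the
  restriction to finitely many of them.\<close>
lemma truncated_maximal_inequality_infinite:
  fixes Y :: "nat \<Rightarrow> 'a \<Rightarrow> real"
  assumes ind: "indep_vars (\<lambda>_. borel) Y UNIV"
    and int: "\<And>i. integrable M (Y i)"
    and mean: "\<And>i. expectation (Y i) = 0"
    and \<delta>: "\<delta> > 0"
    and bound: "\<And>n. (\<Sum>i<n. expectation (\<lambda>\<omega>. min_abs_sq (Y i \<omega>))) \<le> B"
  shows "prob {\<omega> \<in> space M. \<exists>k. \<bar>\<Sum>i<k. Y i \<omega>\<bar> > \<delta>} \<le> (4 / \<delta>\<^sup>2 + 4 / \<delta>) * B"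
proof -
  have rv [measurable]: "Y i \<in> borel_measurable M" for i
    using ind by (auto simp: indep_vars_def)
  define E where "E n = {\<omega> \<in> space M. \<exists>k\<le>n. \<bar>\<Sum>i<k. Y i \<omega>\<bar> > \<delta>}" for n
  have "range E \<subseteq> events"
    unfolding E_def by auto
  moreover have "incseq E"
    unfolding E_def by (intro incseq_SucI) (auto intro: le_SucI)
  ultimately have "(\<lambda>n. prob (E n)) \<longlonglongrightarrow> prob (\<Union>n. E n)"
    by (rule finite_Lim_measure_incseq)
  moreover have "(\<Union>n. E n) = {\<omega> \<in> space M. \<exists>k. \<bar>\<Sum>i<k. Y i \<omega>\<bar> > \<delta>}"
    unfolding E_def by auto
  moreover have "prob (E n) \<le> (4 / \<delta>\<^sup>2 + 4 / \<delta>) * B" for n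
  proof -
    have "prob (E n) \<le> (4 / \<delta>\<^sup>2 + 4 / \<delta>) * (\<Sum>i<n. expectation (\<lambda>\<omega>. min_abs_sq (Y i \<omega>)))"
      unfolding E_def by (rule truncated_maximal_inequality[OF ind int mean \<delta>])
    also have "\<dots> \<le> (4 / \<delta>\<^sup>2 + 4 / \<delta>) * B"
      using \<delta> by (intro mult_left_mono bound) simp
    finally show ?thesis .
  qed
  ultimately show ?thesis
    by (intro LIMSEQ_le_const2) auto
qed

text \<open>
  By the maximal inequality, the sums starting at \<open>m\<close> stay within \<open>\<delta>\<close> up to probability of the order
  of the tail from \<open>m\<close> of a convergent series. Hence almost surely some \<open>m\<close> works for each
  \<open>\<delta> = 1 / (l + 1)\<close>, which is the Cauchy criterion.
\<close>
theorem independent_series_converges: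
  fixes Y :: "nat \<Rightarrow> 'a \<Rightarrow> real"
  assumes ind: "indep_vars (\<lambda>_. borel) Y UNIV"
    and int: "\<And>i. integrable M (Y i)"
    and mean: "\<And>i. expectation (Y i) = 0"
    and summable: "summable (\<lambda>i. expectation (\<lambda>\<omega>. min_abs_sq (Y i \<omega>)))"
  shows "AE \<omega> in M. summable (\<lambda>i. Y i \<omega>)"
proof -
  have rv [measurable]: "Y i \<in> borel_measurable M" for i
    using ind by (auto simp: indep_vars_def)
  let ?g = "\<lambda>i. expectation (\<lambda>\<omega>. min_abs_sq (Y i \<omega>))"
  have oscillation: "AE \<omega> in M. \<exists>m. \<forall>k. \<bar>\<Sum>i<k. Y (i + m) \<omega>\<bar> \<le> \<delta>" if \<delta>: "\<delta> > 0" for \<delta>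
  proof -
    define N where "N = {\<omega> \<in> space M. \<forall>m. \<exists>k. \<bar>\<Sum>i<k. Y (i + m) \<omega>\<bar> > \<delta>}"
    have N_ev: "N \<in> events" unfolding N_def by measurable
    have "prob N \<le> (4 / \<delta>\<^sup>2 + 4 / \<delta>) * (\<Sum>i. ?g (i + m))" for m
    proof -
      have "prob N \<le> prob {\<omega> \<in> space M. \<exists>k. \<bar>\<Sum>i<k. Y (i + m) \<omega>\<bar> > \<delta>}"
        by (rule finite_measure_mono) (auto simp: N_def)
      also have "\<dots> \<le> (4 / \<delta>\<^sup>2 + 4 / \<delta>) * (\<Sum>i. ?g (i + m))"
      proof (rule truncated_maximal_inequality_infinite[OF _ int mean \<delta>])
        show "indep_vars (\<lambda>_. borel) (\<lambda>i. Y (i + m)) UNIV"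
          by (rule indep_vars_reindex) (auto intro: indep_vars_subset[OF ind])
        show "(\<Sum>i<n. ?g (i + m)) \<le> (\<Sum>i. ?g (i + m))" for n
          using summable_ignore_initial_segment[OF summable, of m]
          by (intro sum_le_suminf) (auto intro: integral_nonneg_AE)
      qed
      finally show ?thesis .
    qed
    moreover have "(\<lambda>m. (4 / \<delta>\<^sup>2 + 4 / \<delta>) * (\<Sum>i. ?g (i + m))) \<longlonglongrightarrow> (4 / \<delta>\<^sup>2 + 4 / \<delta>) * 0"
      by (intro tendsto_mult_left suminf_exist_split2 summable)
    ultimately have "prob N \<le> (4 / \<delta>\<^sup>2 + 4 / \<delta>) * 0"
      by (intro LIMSEQ_le_const) auto
    then have "prob N = 0"
      using measure_nonneg[of M N] by simp
    then have "AE \<omega> in M. \<omega> \<notin> N"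
      using N_ev by (intro AE_not_in) (auto simp: null_sets_def emeasure_eq_measure)
    then show ?thesis
      using AE_space by eventually_elim (auto simp: N_def not_less)
  qed
  have "AE \<omega> in M. \<forall>l. \<exists>m. \<forall>k. \<bar>\<Sum>i<k. Y (i + m) \<omega>\<bar> \<le> 1 / real (Suc l)"
    using oscillation by (subst AE_all_countable) simp
  then show ?thesis
  proof eventually_elim
    case (elim \<omega>)
    show ?case
      unfolding summable_Cauchy
    proof (intro allI impI)
      fix e :: real assume "e > 0"
      then obtain l where l: "1 / real (Suc l) < e / 2"
        using reals_Archimedean[of "e / 2"] by (auto simp: inverse_eq_divide)
      from elim obtain m where m: "\<bar>\<Sum>i<k. Y (i + m) \<omega>\<bar> \<le> 1 / real (Suc l)" for k
        by blast
      have tail: "\<bar>\<Sum>i = m..<b. Y i \<omega>\<bar> < e / 2" if "m \<le> b" for b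
        using m[of "b - m"] l that sum.shift_bounds_nat_ivl[of "\<lambda>i. Y i \<omega>" 0 m "b - m"]
        by (simp add: atLeast0LessThan)
      have "norm (\<Sum>i = a..<b. Y i \<omega>) < e" if "m \<le> a" for a b
      proof (cases "a \<le> b")
        case True
        then have "(\<Sum>i = m..<b. Y i \<omega>) = (\<Sum>i = m..<a. Y i \<omega>) + (\<Sum>i = a..<b. Y i \<omega>)"
          using that by (simp add: sum.atLeastLessThan_concat)
        then show ?thesis
          using tail[of a] tail[of b] that True unfolding real_norm_def by linarith
      qed (use \<open>e > 0\<close> in simp)
      then show "\<exists>N. \<forall>m\<ge>N. \<forall>n. norm (sum (\<lambda>i. Y i \<omega>) {m..<n}) < e" by blast
    qed
  qed
qed

end

section \<open>Summing the truncated powers over time\<close>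

text \<open>
  A discrete comparison of \<open>n powr (- s)\<close> with its integral. With \<open>r = n / (n + 1)\<close> it says
  \<open>1 + (s - 1) * (1 - r) \<le> r powr (1 - s)\<close>, which follows from \<open>ln r \<le> r - 1\<close> and \<open>1 + u \<le> exp u\<close>.
\<close>
lemma powr_telescope:
  fixes s :: real
  assumes "n > 0" "s > 1"
  shows "(s - 1) * real (Suc n) powr (- s) \<le> real n powr (1 - s) - real (Suc n) powr (1 - s)"
proof -
  define r where "r = real n / real (Suc n)"
  have r: "0 < r" "1 - r = 1 / real (Suc n)"
    using assms by (auto simp: r_def field_simps)
  have "(s - 1) * (1 - r) \<le> (s - 1) * (- ln r)"
    using assms ln_le_minus_one[OF r(1)] by (intro mult_left_mono) auto
  then have "1 + (s - 1) * (1 / real (Suc n)) \<le> 1 + (1 - s) * ln r"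
    using r(2) by (simp add: algebra_simps)
  also have "\<dots> \<le> r powr (1 - s)"
    using r(1) exp_ge_add_one_self[of "(1 - s) * ln r"] by (simp add: powr_def)
  also have "\<dots> = real n powr (1 - s) / real (Suc n) powr (1 - s)"
    unfolding r_def by (simp add: powr_divide)
  finally have "(1 + (s - 1) * (1 / real (Suc n))) * real (Suc n) powr (1 - s) \<le> real n powr (1 - s)"
    using assms by (simp add: pos_le_divide_eq)
  moreover have "1 / real (Suc n) * real (Suc n) powr (1 - s) = real (Suc n) powr (- s)"
    by (simp add: powr_diff powr_minus field_simps)
  ultimately show ?thesis
    by (simp only: distrib_right mult.assoc mult_1)
qed

lemma harmonic_le_ln: "(\<Sum>n=1..Suc M. 1 / real n) \<le> 1 + ln (real (Suc M))"
proof (induction M)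
  case (Suc M)
  have "ln (real (Suc M) / real (Suc (Suc M))) \<le> real (Suc M) / real (Suc (Suc M)) - 1"
    by (rule ln_le_minus_one) simp
  also have "\<dots> = - (1 / real (Suc (Suc M)))"
    by (simp add: field_simps)
  finally have "1 / real (Suc (Suc M)) \<le> ln (real (Suc (Suc M))) - ln (real (Suc M))"
    by (simp add: ln_div)
  then show ?case
    using Suc by simp
qed simp

text \<open>
  The two terms of the minimum agree at \<open>n = t\<close>. Up to \<open>M = \<lfloor>t\<rfloor>\<close> the harmonic sum gives the logarithm;
  beyond \<open>M\<close> the other terms telescope to at most \<open>(t / M) powr (s - 1) / (s - 1)\<close>, where \<open>t \<le> 2 * M\<close>.
\<close>
lemma sum_min_harmonic_powr_le:
  fixes s t :: real
  assumes s: "s > 1" and t: "t \<ge> 1"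
  shows "(\<Sum>n=1..N. min (1 / real n) (real n powr (- s) * t powr (s - 1)))
    \<le> 1 + ln t + 2 powr (s - 1) / (s - 1)"
proof -
  define m where "m n = min (1 / real n) (real n powr (- s) * t powr (s - 1))" for n
  define M where "M = nat \<lfloor>t\<rfloor>"
  have M: "1 \<le> M" "real M \<le> t" "t \<le> 2 * real M"
  proof -
    have "real M = of_int \<lfloor>t\<rfloor>" and "1 \<le> \<lfloor>t\<rfloor>"
      using t by (simp_all add: M_def)
    then show "1 \<le> M" "real M \<le> t" "t \<le> 2 * real M"
      by linarith+
  qed
  have m_nonneg: "0 \<le> m n" for n by (simp add: m_def)
  have past_M: "(\<Sum>n=1..N. m n)
      \<le> 1 + ln t + t powr (s - 1) * (real M powr (1 - s) - real N powr (1 - s)) / (s - 1)"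
    if "M \<le> N" for N
    using that
  proof (induction N rule: dec_induct)
    case base
    obtain M' where M': "M = Suc M'" using M by (cases M) auto
    have "(\<Sum>n=1..M. m n) \<le> (\<Sum>n=1..M. 1 / real n)"
      by (intro sum_mono) (simp add: m_def)
    also have "\<dots> \<le> 1 + ln (real M)"
      unfolding M' by (rule harmonic_le_ln)
    also have "\<dots> \<le> 1 + ln t"
      using M by simp
    finally show ?case by simp
  next
    case (step N)
    have "m (Suc N) \<le> t powr (s - 1) * real (Suc N) powr (- s)"
      unfolding m_def mult.commute[of "t powr (s - 1)"] by (rule min.cobounded2)
    also have "real (Suc N) powr (- s) \<le> (real N powr (1 - s) - real (Suc N) powr (1 - s)) / (s - 1)"
      using powr_telescope[of N s] s M step by (simp add: pos_le_divide_eq mult.commute)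
    finally have "m (Suc N)
        \<le> t powr (s - 1) * ((real N powr (1 - s) - real (Suc N) powr (1 - s)) / (s - 1))"
      by (simp add: mult_left_mono)
    then show ?case
      using step.IH s by (simp add: field_simps)
  qed
  have "(\<Sum>n=1..N. m n) \<le> (\<Sum>n=1..max N M. m n)"
    by (intro sum_mono2) (auto simp: m_nonneg)
  also have "\<dots> \<le> 1 + ln t
      + t powr (s - 1) * (real M powr (1 - s) - real (max N M) powr (1 - s)) / (s - 1)"
    by (rule past_M) simp
  also have "\<dots> \<le> 1 + ln t + t powr (s - 1) * real M powr (1 - s) / (s - 1)"
    using s by (intro add_left_mono divide_right_mono mult_left_mono) auto
  also have "t powr (s - 1) * real M powr (1 - s) = (t / real M) powr (s - 1)"
    using M t by (simp add: powr_divide powr_diff field_simps)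
  also have "(t / real M) powr (s - 1) / (s - 1) \<le> 2 powr (s - 1) / (s - 1)"
    using s M t by (intro divide_right_mono powr_mono2) (auto simp: field_simps)
  finally show ?thesis by (simp add: m_def)
qed

text \<open>
  The previous lemma with \<open>t = max 1 (y powr p)\<close> and \<open>s = q / p\<close>, so that \<open>y powr q \<le> t powr s\<close>; the
  maximum with \<open>1\<close> takes care of small \<open>y\<close>.
\<close>
lemma sum_min_powr_le_log_moment:
  fixes p q C y :: real
  assumes p: "0 < p" and pq: "p < q" and C: "0 \<le> C" and y: "0 \<le> y"
  shows "(\<Sum>n=1..N. min (y powr p) (C * real n powr (1 - q / p) * y powr q) / real n)
    \<le> (1 + C) * ((1 + 2 powr (q / p - 1) / (q / p - 1)) * (1 + y powr p)
        + p * (y powr p * ln (1 + y)))"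
proof -
  define s where "s = q / p"
  define t where "t = max 1 (y powr p)"
  define K where "K = 1 + 2 powr (s - 1) / (s - 1)"
  have s: "s > 1" using p pq by (simp add: s_def)
  have t: "t \<ge> 1" by (simp add: t_def)
  have K: "K \<ge> 0" using s by (simp add: K_def)
  have yt: "y powr p \<le> t" by (simp add: t_def)
  have "y powr q = (y powr p) powr s"
    using p by (simp add: powr_powr s_def)
  also have "\<dots> \<le> t powr s"
    using s yt by (intro powr_mono2) auto
  finally have yq: "y powr q \<le> t powr s" .
  have "min (y powr p) (C * real n powr (1 - s) * y powr q) / real n
      \<le> (1 + C) * t * min (1 / real n) (real n powr (- s) * t powr (s - 1))" if n: "n \<ge> 1" for n :: nat
  proof -
    have "min (y powr p) (C * real n powr (1 - s) * y powr q)
        \<le> min t (C * (real n powr (1 - s) * t powr s))"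
      using C yt yq by (intro min.mono) (auto simp: mult.assoc intro!: mult_left_mono)
    also have "\<dots> \<le> (1 + C) * min t (real n powr (1 - s) * t powr s)"
    proof (cases "t \<le> real n powr (1 - s) * t powr s")
      case True
      have "min t (C * (real n powr (1 - s) * t powr s)) \<le> 1 * t" by simp
      also have "\<dots> \<le> (1 + C) * t" using C t by (intro mult_right_mono) auto
      finally show ?thesis using True by (simp add: min_absorb1)
    next
      case False
      have "min t (C * (real n powr (1 - s) * t powr s)) \<le> C * (real n powr (1 - s) * t powr s)"
        by simp
      also have "\<dots> \<le> (1 + C) * (real n powr (1 - s) * t powr s)"
        by (intro mult_right_mono) auto
      finally show ?thesis using False by (simp add: min_absorb2)
    qed
    finally have "min (y powr p) (C * real n powr (1 - s) * y powr q) / real n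
        \<le> (1 + C) * (min t (real n powr (1 - s) * t powr s) / real n)"
      using n by (simp add: divide_right_mono)
    also have "min t (real n powr (1 - s) * t powr s) / real n
        = min (t / real n) (real n powr (1 - s) * t powr s / real n)"
      using n by (simp add: min_divide_distrib_right)
    also have "\<dots> = t * min (1 / real n) (real n powr (- s) * t powr (s - 1))"
    proof -
      have "real n powr (1 - s) * t powr s / real n = t * (real n powr (- s) * t powr (s - 1))"
        using n t by (simp add: powr_diff powr_minus field_simps)
      then show ?thesis using t by (simp add: min_mult_distrib_left)
    qed
    finally show ?thesis by (simp add: mult.assoc)
  qed
  then have "(\<Sum>n=1..N. min (y powr p) (C * real n powr (1 - s) * y powr q) / real n)
      \<le> (\<Sum>n=1..N. (1 + C) * t * min (1 / real n) (real n powr (- s) * t powr (s - 1)))"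
    by (intro sum_mono) auto
  also have "\<dots> \<le> (1 + C) * t * (1 + ln t + 2 powr (s - 1) / (s - 1))"
    unfolding sum_distrib_left[symmetric]
    using C t by (intro mult_left_mono sum_min_harmonic_powr_le s) auto
  also have "\<dots> = (1 + C) * (K * t + t * ln t)"
    by (simp add: K_def algebra_simps)
  also have "\<dots> \<le> (1 + C) * (K * (1 + y powr p) + p * (y powr p * ln (1 + y)))"
  proof (intro mult_left_mono add_mono)
    show "t \<le> 1 + y powr p" by (simp add: t_def)
    show "t * ln t \<le> p * (y powr p * ln (1 + y))"
    proof (cases "y powr p \<le> 1")
      case True
      then show ?thesis using p y by (simp add: t_def)
    next
      case False
      then have "y > 0" using y by (cases "y = 0") auto
      moreover have "t = y powr p" using False by (simp add: t_def)
      ultimately have "t * ln t = p * (y powr p * ln y)"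
        by (simp add: ln_powr)
      also have "\<dots> \<le> p * (y powr p * ln (1 + y))"
        using \<open>y > 0\<close> p by (intro mult_left_mono) auto
      finally show ?thesis .
    qed
  qed (use C K in auto)
  finally show ?thesis by (simp add: s_def K_def)
qed

section \<open>Weights of a causal linear process\<close>

lemma summable_abs_powr_add:
  fixes x y :: "nat \<Rightarrow> real"
  assumes r: "0 \<le> r" and x: "summable (\<lambda>m. \<bar>x m\<bar> powr r)" and y: "summable (\<lambda>m. \<bar>y m\<bar> powr r)"
  shows "summable (\<lambda>m. \<bar>x m + y m\<bar> powr r)"
proof (rule summable_comparison_test')
  show "summable (\<lambda>m. 2 powr r * (\<bar>x m\<bar> powr r + \<bar>y m\<bar> powr r))"
    by (intro summable_mult summable_add x y)
  fix m
  have "\<bar>x m + y m\<bar> powr r \<le> (2 * max \<bar>x m\<bar> \<bar>y m\<bar>) powr r"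
    using r by (intro powr_mono2) auto
  also have "\<dots> = 2 powr r * max \<bar>x m\<bar> \<bar>y m\<bar> powr r"
    by (simp add: powr_mult)
  also have "\<dots> \<le> 2 powr r * (\<bar>x m\<bar> powr r + \<bar>y m\<bar> powr r)"
    by (intro mult_left_mono) (auto simp: max_def)
  finally show "norm (\<bar>x m + y m\<bar> powr r) \<le> 2 powr r * (\<bar>x m\<bar> powr r + \<bar>y m\<bar> powr r)"
    by simp
qed

lemma summable_abs_powr_sum:
  fixes x :: "'i \<Rightarrow> nat \<Rightarrow> real"
  assumes "finite A" "0 < r" "\<And>k. k \<in> A \<Longrightarrow> summable (\<lambda>m. \<bar>x k m\<bar> powr r)"
  shows "summable (\<lambda>m. \<bar>\<Sum>k\<in>A. x k m\<bar> powr r)"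
  using assms by (induction A rule: finite_induct) (auto intro: summable_abs_powr_add)

lemma summable_abs_powr_mono:
  fixes x :: "nat \<Rightarrow> real"
  assumes p: "0 < p" "p \<le> r" and x: "summable (\<lambda>m. \<bar>x m\<bar> powr p)"
  shows "summable (\<lambda>m. \<bar>x m\<bar> powr r)"
proof -
  have "eventually (\<lambda>m. \<bar>x m\<bar> powr p < 1) sequentially"
    using summable_LIMSEQ_zero[OF x] by (rule order_tendstoD) simp
  then have "eventually (\<lambda>m. norm (\<bar>x m\<bar> powr r) \<le> \<bar>x m\<bar> powr p) sequentially"
  proof eventually_elim
    case (elim m)
    show ?case
    proof (cases "x m = 0")
      case False
      have "\<bar>x m\<bar> < 1"
        using elim p ge_one_powr_ge_zero[of "\<bar>x m\<bar>" p] by fastforce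
      then show ?thesis using False p by (simp add: powr_mono')
    qed simp
  qed
  then show ?thesis using x by (rule summable_comparison_test_ev)
qed

text \<open>
  The series for \<open>X\<^sub>k\<close> runs over lags \<open>j\<close>, counted back from time \<open>k\<close>. Counting every such series back
  from the common time \<open>n\<close> instead makes the series for \<open>k = 1, \<dots>, n\<close> run over the same innovations,
  so that they can be added term by term; causality makes the \<open>n - k\<close> extra initial terms vanish.
  The function \<open>f\<close> allows the same shift to serve for \<open>\<bar>\<psi>\<bar> powr r\<close> and for \<open>\<psi> * \<epsilon>\<close>.
\<close>
lemma causal_shift_sums_iff:
  fixes \<psi> :: "int \<Rightarrow> real" and f :: "int \<Rightarrow> real \<Rightarrow> 'b::real_normed_vector"
  assumes causal: "\<And>j. j < 0 \<Longrightarrow> \<psi> j = 0" and "\<And>j. f j 0 = 0" and "k \<le> n"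
  shows "(\<lambda>m. f (int n - int m) (\<psi> (int k - (int n - int m)))) sums S \<longleftrightarrow>
    (\<lambda>j. f (int k - int j) (\<psi> (int j))) sums S"
proof -
  have "(\<lambda>j. f (int k - int j) (\<psi> (int j))) =
      (\<lambda>j. f (int n - int (j + (n - k))) (\<psi> (int k - (int n - int (j + (n - k))))))"
    using \<open>k \<le> n\<close> by (simp add: of_nat_diff algebra_simps)
  moreover have "f (int n - int m) (\<psi> (int k - (int n - int m))) = 0" if "m < n - k" for m
  proof -
    have "\<psi> (int k - (int n - int m)) = 0" using that by (intro causal) linarith
    then show ?thesis using assms(2) by simp
  qed
  ultimately show ?thesis
    using sums_zero_iff_shift[of "n - k" "\<lambda>m. f (int n - int m) (\<psi> (int k - (int n - int m)))" S]
    by simp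
qed

lemma weight_powr_summable:
  assumes causal: "\<And>j. j < 0 \<Longrightarrow> \<psi> j = 0"
    and p: "0 < p" "p \<le> r" and \<psi>: "summable (\<lambda>j. \<bar>\<psi> (int j)\<bar> powr p)"
  shows "summable (\<lambda>m. \<bar>weight \<psi> n (int n - int m)\<bar> powr r)"
proof -
  have "summable (\<lambda>j. \<bar>\<psi> (int j)\<bar> powr r)"
    by (rule summable_abs_powr_mono[OF p \<psi>])
  then obtain S where S: "(\<lambda>j. \<bar>\<psi> (int j)\<bar> powr r) sums S"
    unfolding summable_def by blast
  have "summable (\<lambda>m. \<bar>\<psi> (int k - (int n - int m))\<bar> powr r)" if "k \<le> n" for k
    using causal_shift_sums_iff[of \<psi> "\<lambda>_ x. \<bar>x\<bar> powr r", OF causal _ that] S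
    by (intro sums_summable[of _ S]) simp
  then show ?thesis
    unfolding weight_def using p by (intro summable_abs_powr_sum) auto
qed

text \<open>
  Summability of the family is essential here: without it the infinite sum in \<open>weight_norm\<close> would be
  the default value \<open>0\<close>.
\<close>
lemma sum_weight_powr_le:
  assumes causal: "\<And>j. j < 0 \<Longrightarrow> \<psi> j = 0"
    and p: "0 < p" "p \<le> r" and \<psi>: "summable (\<lambda>j. \<bar>\<psi> (int j)\<bar> powr p)"
  shows "(\<Sum>m<k. \<bar>weight \<psi> n (int n - int m)\<bar> powr r) \<le> weight_norm \<psi> n r powr r"
proof -
  let ?f = "\<lambda>j. \<bar>weight \<psi> n j\<bar> powr r"
  have bij: "bij_betw (\<lambda>m. int n - int m) UNIV {..int n}"
    by (rule bij_betw_byWitness[where f' = "\<lambda>j. nat (int n - j)"]) auto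
  have "(\<lambda>m. ?f (int n - int m)) summable_on UNIV"
    using weight_powr_summable[OF causal p \<psi>] by (simp add: summable_on_UNIV_nonneg_real_iff)
  then have "(\<Sum>m<k. ?f (int n - int m)) \<le> (\<Sum>\<^sub>\<infinity>m. ?f (int n - int m))"
    by (rule finite_sum_le_infsum) auto
  also have "\<dots> = infsum ?f {..int n}"
    by (rule infsum_reindex_bij_betw[OF bij])
  also have "\<dots> = weight_norm \<psi> n r powr r"
    unfolding weight_norm_def using p by (simp add: powr_powr infsum_nonneg)
  finally show ?thesis .
qed

section \<open>Weighted series of the innovations\<close>

locale iid_log_moment = prob_space M for M :: "'a measure" +
  fixes \<epsilon> :: "int \<Rightarrow> 'a \<Rightarrow> real" and p :: real
  assumes p: "1 < p" "p < 2"
    and indep: "indep_vars (\<lambda>_. borel) \<epsilon> UNIV"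
    and ident: "distr M borel (\<epsilon> k) = distr M borel (\<epsilon> 0)"
    and log_moment: "integrable M (\<lambda>\<omega>. \<bar>\<epsilon> 0 \<omega>\<bar> powr p * ln (1 + \<bar>\<epsilon> 0 \<omega>\<bar>))"
    and centred: "expectation (\<epsilon> 0) = 0"
begin

lemma rv [measurable]: "\<epsilon> k \<in> borel_measurable M"
  using indep by (auto simp: indep_vars_def)

text \<open>For \<open>x \<ge> 1\<close> the factor \<open>ln (1 + x)\<close> is at least \<open>ln 2\<close>.\<close>
lemma moment: "integrable M (\<lambda>\<omega>. \<bar>\<epsilon> 0 \<omega>\<bar> powr p)"
proof (rule Bochner_Integration.integrable_bound)
  show "integrable M (\<lambda>\<omega>. 1 + \<bar>\<epsilon> 0 \<omega>\<bar> powr p * ln (1 + \<bar>\<epsilon> 0 \<omega>\<bar>) / ln 2)"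
    using log_moment by simp
  have "x powr p \<le> 1 + x powr p * ln (1 + x) / ln 2" if "x \<ge> 0" for x :: real
  proof (cases "x \<le> 1")
    case True
    then have "x powr p \<le> 1 powr p"
      using that p by (intro powr_mono2) auto
    moreover have "0 \<le> x powr p * ln (1 + x) / ln 2"
      using that by simp
    ultimately show ?thesis by simp
  next
    case False
    then have "x powr p * ln 2 \<le> x powr p * ln (1 + x)"
      by (intro mult_left_mono) auto
    then have "x powr p \<le> x powr p * ln (1 + x) / ln 2"
      by (simp add: pos_le_divide_eq)
    then show ?thesis by simp
  qed
  then show "AE \<omega> in M. norm (\<bar>\<epsilon> 0 \<omega>\<bar> powr p) \<le>
      norm (1 + \<bar>\<epsilon> 0 \<omega>\<bar> powr p * ln (1 + \<bar>\<epsilon> 0 \<omega>\<bar>) / ln 2)"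
    by (intro AE_I2) (force intro: order_trans[OF _ abs_ge_self])
qed simp

lemma integrable_innovation_0: "integrable M (\<epsilon> 0)"
proof (rule Bochner_Integration.integrable_bound)
  show "integrable M (\<lambda>\<omega>. 1 + \<bar>\<epsilon> 0 \<omega>\<bar> powr p)"
    using moment by simp
  have "\<bar>x\<bar> \<le> 1 + \<bar>x\<bar> powr p" for x :: real
  proof (cases "\<bar>x\<bar> \<le> 1")
    case False
    then have "\<bar>x\<bar> powr 1 \<le> \<bar>x\<bar> powr p" using p by (intro powr_mono) auto
    then show ?thesis using False by simp
  qed (simp add: add_increasing2)
  then show "AE \<omega> in M. norm (\<epsilon> 0 \<omega>) \<le> norm (1 + \<bar>\<epsilon> 0 \<omega>\<bar> powr p)"
    by (intro AE_I2) simp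
qed simp

lemma transfer_integrable:
  assumes "f \<in> borel_measurable borel"
  shows "integrable M (\<lambda>\<omega>. f (\<epsilon> k \<omega>)) \<longleftrightarrow> integrable M (\<lambda>\<omega>. f (\<epsilon> 0 \<omega>) :: real)"
  using integrable_distr_eq[OF rv assms, of k] integrable_distr_eq[OF rv assms, of 0] ident[of k]
  by simp

lemma transfer_expectation:
  assumes "f \<in> borel_measurable borel"
  shows "expectation (\<lambda>\<omega>. f (\<epsilon> k \<omega>)) = expectation (\<lambda>\<omega>. f (\<epsilon> 0 \<omega>) :: real)"
  using integral_distr[OF rv assms, of k] integral_distr[OF rv assms, of 0] ident[of k]
  by simp

lemma integrable_min_abs_sq: "integrable M (\<lambda>\<omega>. min_abs_sq (c * \<epsilon> 0 \<omega>))"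
  by (rule Bochner_Integration.integrable_bound[where f = "\<lambda>\<omega>. c * \<epsilon> 0 \<omega>"])
     (use integrable_innovation_0 in \<open>auto simp: min_abs_sq_le_abs\<close>)

context
  fixes a :: "nat \<Rightarrow> real" and f :: "nat \<Rightarrow> int"
  assumes f: "inj f"
begin

lemma weighted_indep: "indep_vars (\<lambda>_. borel) (\<lambda>i \<omega>. a i * \<epsilon> (f i) \<omega>) UNIV"
proof -
  have "indep_vars (\<lambda>_. borel) (\<lambda>i. \<epsilon> (f i)) UNIV"
    by (rule indep_vars_reindex[OF f]) (rule indep_vars_subset[OF indep subset_UNIV])
  then show ?thesis by (rule indep_vars_compose2) simp
qed

lemma weighted_integrable: "integrable M (\<lambda>\<omega>. a i * \<epsilon> (f i) \<omega>)"
  using transfer_integrable[of "\<lambda>x. x"] integrable_innovation_0 by simp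

lemma weighted_centred: "expectation (\<lambda>\<omega>. a i * \<epsilon> (f i) \<omega>) = 0"
  using transfer_expectation[of "\<lambda>x. x"] centred by simp

lemma weighted_min_abs_sq:
  "expectation (\<lambda>\<omega>. min_abs_sq (a i * \<epsilon> (f i) \<omega>)) = expectation (\<lambda>\<omega>. min_abs_sq (a i * \<epsilon> 0 \<omega>))"
  by (rule transfer_expectation) measurable

lemma weighted_series_converges:
  assumes a: "summable (\<lambda>i. \<bar>a i\<bar> powr p)"
  shows "AE \<omega> in M. summable (\<lambda>i. a i * \<epsilon> (f i) \<omega>)"
proof (rule independent_series_converges[OF weighted_indep weighted_integrable weighted_centred])
  have "expectation (\<lambda>\<omega>. min_abs_sq (a i * \<epsilon> 0 \<omega>))
      \<le> \<bar>a i\<bar> powr p * expectation (\<lambda>\<omega>. \<bar>\<epsilon> 0 \<omega>\<bar> powr p)" for i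
  proof -
    have "expectation (\<lambda>\<omega>. min_abs_sq (a i * \<epsilon> 0 \<omega>))
        \<le> expectation (\<lambda>\<omega>. \<bar>a i\<bar> powr p * \<bar>\<epsilon> 0 \<omega>\<bar> powr p)"
    proof (rule integral_mono[OF integrable_min_abs_sq])
      show "min_abs_sq (a i * \<epsilon> 0 \<omega>) \<le> \<bar>a i\<bar> powr p * \<bar>\<epsilon> 0 \<omega>\<bar> powr p" for \<omega>
        using min_abs_sq_le_powr[of p "a i * \<epsilon> 0 \<omega>"] p by (simp add: abs_mult powr_mult)
    qed (use moment in simp)
    then show ?thesis by simp
  qed
  then show "summable (\<lambda>i. expectation (\<lambda>\<omega>. min_abs_sq (a i * \<epsilon> (f i) \<omega>)))"
    unfolding weighted_min_abs_sq
    by (intro summable_comparison_test'[OF summable_mult2[OF a]])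
       (auto simp: abs_of_nonneg integral_nonneg_AE)
qed

text \<open>
  The two bounds on \<open>min_abs_sq\<close>, by the powers \<open>p\<close> and \<open>q\<close>, are summed over \<open>i\<close> separately for each sample
  point. The minimum of the results has to stay inside the expectation: the \<open>q\<close>-th moment of the
  innovations may be infinite.
\<close>
lemma weighted_series_tail:
  assumes q: "1 \<le> q" "q \<le> 2" and \<delta>: "\<delta> > 0"
    and ap: "\<And>k. (\<Sum>i<k. \<bar>a i\<bar> powr p) \<le> 1"
    and aq: "\<And>k. (\<Sum>i<k. \<bar>a i\<bar> powr q) \<le> D"
  shows "prob {\<omega> \<in> space M. \<exists>k. \<bar>\<Sum>i<k. a i * \<epsilon> (f i) \<omega>\<bar> > \<delta>}
    \<le> (4 / \<delta>\<^sup>2 + 4 / \<delta>) * expectation (\<lambda>\<omega>. min (\<bar>\<epsilon> 0 \<omega>\<bar> powr p) (D * \<bar>\<epsilon> 0 \<omega>\<bar> powr q))"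
proof (rule truncated_maximal_inequality_infinite[OF weighted_indep weighted_integrable
      weighted_centred \<delta>])
  fix k
  have D: "D \<ge> 0" using aq[of 0] by simp
  have "(\<Sum>i<k. expectation (\<lambda>\<omega>. min_abs_sq (a i * \<epsilon> (f i) \<omega>)))
      = expectation (\<lambda>\<omega>. \<Sum>i<k. min_abs_sq (a i * \<epsilon> 0 \<omega>))"
    unfolding weighted_min_abs_sq using integrable_min_abs_sq by simp
  also have "\<dots> \<le> expectation (\<lambda>\<omega>. min (\<bar>\<epsilon> 0 \<omega>\<bar> powr p) (D * \<bar>\<epsilon> 0 \<omega>\<bar> powr q))"
  proof (rule integral_mono)
    show "integrable M (\<lambda>\<omega>. \<Sum>i<k. min_abs_sq (a i * \<epsilon> 0 \<omega>))"
      using integrable_min_abs_sq by simp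
    show "integrable M (\<lambda>\<omega>. min (\<bar>\<epsilon> 0 \<omega>\<bar> powr p) (D * \<bar>\<epsilon> 0 \<omega>\<bar> powr q))"
      by (rule Bochner_Integration.integrable_bound[OF moment]) (use D in auto)
    fix \<omega>
    have le: "(\<Sum>i<k. min_abs_sq (a i * \<epsilon> 0 \<omega>)) \<le> (\<Sum>i<k. \<bar>a i\<bar> powr r) * \<bar>\<epsilon> 0 \<omega>\<bar> powr r"
      if "1 \<le> r" "r \<le> 2" for r
      unfolding sum_distrib_right
      using min_abs_sq_le_powr[OF that] by (intro sum_mono) (metis abs_mult powr_mult abs_ge_zero)
    have "(\<Sum>i<k. \<bar>a i\<bar> powr p) * \<bar>\<epsilon> 0 \<omega>\<bar> powr p \<le> 1 * \<bar>\<epsilon> 0 \<omega>\<bar> powr p"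
      by (intro mult_right_mono ap) simp
    moreover have "(\<Sum>i<k. \<bar>a i\<bar> powr q) * \<bar>\<epsilon> 0 \<omega>\<bar> powr q \<le> D * \<bar>\<epsilon> 0 \<omega>\<bar> powr q"
      by (intro mult_right_mono aq) simp
    ultimately show "(\<Sum>i<k. min_abs_sq (a i * \<epsilon> 0 \<omega>))
        \<le> min (\<bar>\<epsilon> 0 \<omega>\<bar> powr p) (D * \<bar>\<epsilon> 0 \<omega>\<bar> powr q)"
      using le[of p] le[of q] p q by simp
  qed
  finally show "(\<Sum>i<k. expectation (\<lambda>\<omega>. min_abs_sq (a i * \<epsilon> (f i) \<omega>)))
    \<le> expectation (\<lambda>\<omega>. min (\<bar>\<epsilon> 0 \<omega>\<bar> powr p) (D * \<bar>\<epsilon> 0 \<omega>\<bar> powr q))" .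
qed

end

lemma partial_sum_eq_weighted_series:
  assumes causal: "\<And>j. j < 0 \<Longrightarrow> \<psi> j = 0" and \<psi>: "summable (\<lambda>j. \<bar>\<psi> (int j)\<bar> powr p)"
  shows "AE \<omega> in M. (\<lambda>m. weight \<psi> n (int n - int m) * \<epsilon> (int n - int m) \<omega>) sums
    partial_sum \<psi> \<epsilon> n \<omega>"
proof -
  have "AE \<omega> in M. summable (\<lambda>j. \<psi> (int j) * \<epsilon> (int k - int j) \<omega>)" for k
    by (rule weighted_series_converges[OF _ \<psi>]) (auto simp: inj_on_def)
  then have "AE \<omega> in M. \<forall>k. summable (\<lambda>j. \<psi> (int j) * \<epsilon> (int k - int j) \<omega>)"
    by (simp add: AE_all_countable)
  then show ?thesis
  proof eventually_elim
    case (elim \<omega>)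
    have "(\<lambda>m. \<psi> (int k - (int n - int m)) * \<epsilon> (int n - int m) \<omega>) sums
        linear_process \<psi> \<epsilon> (int k) \<omega>" if "k \<in> {1..n}" for k
    proof -
      have "(\<lambda>j. \<psi> (int j) * \<epsilon> (int k - int j) \<omega>) sums linear_process \<psi> \<epsilon> (int k) \<omega>"
        unfolding linear_process_def using elim by (intro summable_sums) simp
      then show ?thesis
        using causal_shift_sums_iff[of \<psi> "\<lambda>i x. x * \<epsilon> i \<omega>" k n] causal that by simp
    qed
    then have "(\<lambda>m. \<Sum>k=1..n. \<psi> (int k - (int n - int m)) * \<epsilon> (int n - int m) \<omega>) sums
        partial_sum \<psi> \<epsilon> n \<omega>"
      unfolding partial_sum_def by (rule sums_sum)
    then show ?case
      by (simp add: weight_def sum_distrib_right)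
  qed
qed

section \<open>The normalised partial sums\<close>

text \<open>
  If the limit of a series exceeds \<open>\<delta>\<close> in absolute value, so does one of its partial sums; the event
  is thus contained, up to a null set, in the one controlled by the maximal inequality. If
  \<open>weight_norm \<psi> n p\<close> is \<open>0\<close>, its inverse is \<open>0\<close> too and all normalised weights vanish.
\<close>
lemma normalized_partial_sum_tail:
  assumes causal: "\<And>j. j < 0 \<Longrightarrow> \<psi> j = 0" and \<psi>: "summable (\<lambda>j. \<bar>\<psi> (int j)\<bar> powr p)"
    and q: "p < q" "q \<le> 2" and \<delta>: "\<delta> > 0"
    and ratio: "weight_norm \<psi> n q / weight_norm \<psi> n p \<le> c"
  shows "prob {\<omega> \<in> space M. \<bar>inverse (weight_norm \<psi> n p) * partial_sum \<psi> \<epsilon> n \<omega>\<bar> > \<delta>}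
    \<le> (4 / \<delta>\<^sup>2 + 4 / \<delta>) *
      expectation (\<lambda>\<omega>. min (\<bar>\<epsilon> 0 \<omega>\<bar> powr p) (c powr q * \<bar>\<epsilon> 0 \<omega>\<bar> powr q))"
proof -
  define W where "W = weight_norm \<psi> n p"
  define a where "a m = inverse W * weight \<psi> n (int n - int m)" for m
  have W: "W \<ge> 0" by (simp add: W_def weight_norm_def)
  have norm: "(\<Sum>m<k. \<bar>a m\<bar> powr r) \<le> (weight_norm \<psi> n r / W) powr r" if "p \<le> r" for r k
  proof -
    have "(\<Sum>m<k. \<bar>a m\<bar> powr r)
        = inverse W powr r * (\<Sum>m<k. \<bar>weight \<psi> n (int n - int m)\<bar> powr r)"
      using W by (simp add: a_def abs_mult powr_mult sum_distrib_left)
    also have "\<dots> \<le> inverse W powr r * weight_norm \<psi> n r powr r"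
      using p by (intro mult_left_mono sum_weight_powr_le[OF causal _ that \<psi>]) auto
    also have "\<dots> = (weight_norm \<psi> n r / W) powr r"
      using W by (simp add: powr_mult[symmetric] weight_norm_def divide_inverse mult.commute)
    finally show ?thesis .
  qed
  have "AE \<omega> in M. (\<lambda>m. weight \<psi> n (int n - int m) * \<epsilon> (int n - int m) \<omega>) sums
      partial_sum \<psi> \<epsilon> n \<omega>"
    by (rule partial_sum_eq_weighted_series[OF causal \<psi>])
  then have "AE \<omega> in M. (\<lambda>m. a m * \<epsilon> (int n - int m) \<omega>) sums (inverse W * partial_sum \<psi> \<epsilon> n \<omega>)"
    by eventually_elim (auto simp: a_def mult.assoc intro!: sums_mult)
  then have "AE \<omega> in M. \<bar>inverse W * partial_sum \<psi> \<epsilon> n \<omega>\<bar> > \<delta> \<longrightarrow>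
      (\<exists>k. \<bar>\<Sum>m<k. a m * \<epsilon> (int n - int m) \<omega>\<bar> > \<delta>)"
  proof eventually_elim
    case (elim \<omega>)
    show ?case
    proof (rule impI, rule ccontr)
      assume "\<not> (\<exists>k. \<bar>\<Sum>m<k. a m * \<epsilon> (int n - int m) \<omega>\<bar> > \<delta>)"
      moreover have "(\<lambda>k. \<bar>\<Sum>m<k. a m * \<epsilon> (int n - int m) \<omega>\<bar>)
          \<longlonglongrightarrow> \<bar>inverse W * partial_sum \<psi> \<epsilon> n \<omega>\<bar>"
        using elim by (intro tendsto_rabs) (simp add: sums_def)
      ultimately have "\<bar>inverse W * partial_sum \<psi> \<epsilon> n \<omega>\<bar> \<le> \<delta>"
        by (intro LIMSEQ_le_const2) (auto simp: not_less)
      moreover assume "\<bar>inverse W * partial_sum \<psi> \<epsilon> n \<omega>\<bar> > \<delta>"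
      ultimately show False by simp
    qed
  qed
  then have "prob {\<omega> \<in> space M. \<bar>inverse W * partial_sum \<psi> \<epsilon> n \<omega>\<bar> > \<delta>}
      \<le> prob {\<omega> \<in> space M. \<exists>k. \<bar>\<Sum>m<k. a m * \<epsilon> (int n - int m) \<omega>\<bar> > \<delta>}"
    by (intro finite_measure_mono_AE) auto
  also have "\<dots> \<le> (4 / \<delta>\<^sup>2 + 4 / \<delta>) *
      expectation (\<lambda>\<omega>. min (\<bar>\<epsilon> 0 \<omega>\<bar> powr p) (c powr q * \<bar>\<epsilon> 0 \<omega>\<bar> powr q))"
  proof (rule weighted_series_tail[OF _ _ _ \<delta>])
    show "(\<Sum>i<k. \<bar>a i\<bar> powr p) \<le> 1" for k
      using norm[of p k] by (cases "W = 0") (auto simp: W_def)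
    show "(\<Sum>i<k. \<bar>a i\<bar> powr q) \<le> c powr q" for k
    proof -
      have "(\<Sum>i<k. \<bar>a i\<bar> powr q) \<le> (weight_norm \<psi> n q / W) powr q"
        using norm[of q k] q by simp
      also have "\<dots> \<le> c powr q"
        using ratio W q p by (intro powr_mono2) (auto simp: W_def weight_norm_def)
      finally show ?thesis .
    qed
  qed (use p q in \<open>auto simp: inj_on_def\<close>)
  finally show ?thesis unfolding W_def .
qed

text \<open>The pointwise bound has finite expectation by the logarithmic moment condition.\<close>
lemma summable_expected_min:
  assumes pq: "p < q" and C: "C \<ge> 0"
  shows "summable (\<lambda>n. inverse (real (Suc n)) *
    expectation (\<lambda>\<omega>. min (\<bar>\<epsilon> 0 \<omega>\<bar> powr p) (C * real (Suc n) powr (1 - q / p) * \<bar>\<epsilon> 0 \<omega>\<bar> powr q)))"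
proof (rule summableI_nonneg_bounded)
  let ?h = "\<lambda>n \<omega>. min (\<bar>\<epsilon> 0 \<omega>\<bar> powr p) (C * real n powr (1 - q / p) * \<bar>\<epsilon> 0 \<omega>\<bar> powr q)"
  let ?B = "\<lambda>\<omega>. (1 + C) * ((1 + 2 powr (q / p - 1) / (q / p - 1)) * (1 + \<bar>\<epsilon> 0 \<omega>\<bar> powr p)
        + p * (\<bar>\<epsilon> 0 \<omega>\<bar> powr p * ln (1 + \<bar>\<epsilon> 0 \<omega>\<bar>)))"
  show "0 \<le> inverse (real (Suc n)) * expectation (?h (Suc n))" for n
    using C by (intro mult_nonneg_nonneg integral_nonneg_AE AE_I2) auto
  have h_int: "integrable M (?h n)" for n
    by (rule Bochner_Integration.integrable_bound[OF moment]) (use C in auto)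
  have B_int: "integrable M ?B"
    using moment log_moment by simp
  fix N
  have "(\<Sum>n<N. inverse (real (Suc n)) * expectation (?h (Suc n)))
      = (\<Sum>n=1..N. expectation (?h n) / real n)"
    by (rule sum.reindex_bij_witness[where i = "\<lambda>n. n - 1" and j = Suc])
       (auto simp: divide_inverse mult.commute)
  also have "\<dots> = expectation (\<lambda>\<omega>. \<Sum>n=1..N. ?h n \<omega> / real n)"
    using h_int by simp
  also have "\<dots> \<le> expectation ?B"
    using h_int B_int p pq C
    by (intro integral_mono sum_min_powr_le_log_moment) auto
  finally show "(\<Sum>n<N. inverse (real (Suc n)) * expectation (?h (Suc n))) \<le> expectation ?B" .
qed

end

theorem proposition2:
  fixes M :: "'a measure"
    and \<epsilon> :: "int \<Rightarrow> 'a \<Rightarrow> real"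
    and \<psi> :: "int \<Rightarrow> real"
    and p :: real
  assumes "prob_space M"
    and "1 < p" and "p < 2"
    and "prob_space.indep_vars M (\<lambda>_. borel) \<epsilon> UNIV"
    and "\<And>k. distr M borel (\<epsilon> k) = distr M borel (\<epsilon> 0)"
    and "integrable M (\<lambda>\<omega>. \<bar>\<epsilon> 0 \<omega>\<bar> powr p * ln (1 + \<bar>\<epsilon> 0 \<omega>\<bar>))"
    and "(\<integral>\<omega>. \<epsilon> 0 \<omega> \<partial>M) = 0"
    and "\<And>j. j < 0 \<Longrightarrow> \<psi> j = 0"
    and "summable (\<lambda>j. \<bar>\<psi> (int j)\<bar> powr p)"
    and "\<exists>q. p < q \<and> q \<le> 2 \<and>
      (\<lambda>n. weight_norm \<psi> n q / weight_norm \<psi> n p) \<in> O(\<lambda>n. real n powr (1 / q - 1 / p))"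
  shows "\<forall>\<delta>>0. summable (\<lambda>n. inverse (real (Suc n)) *
    measure M {\<omega> \<in> space M.
      \<bar>inverse (weight_norm \<psi> (Suc n) p) * partial_sum \<psi> \<epsilon> (Suc n) \<omega>\<bar> > \<delta>})"
proof (intro allI impI)
  interpret prob_space M by fact
  interpret iid_log_moment M \<epsilon> p
    by unfold_locales (use assms in auto)
  fix \<delta> :: real assume \<delta>: "\<delta> > 0"
  obtain q where q: "p < q" "q \<le> 2"
    and O: "(\<lambda>n. weight_norm \<psi> n q / weight_norm \<psi> n p) \<in> O(\<lambda>n. real n powr (1 / q - 1 / p))"
    using assms(10) by blast
  obtain c where c: "c > 0"
    and ev: "eventually (\<lambda>n. weight_norm \<psi> n q / weight_norm \<psi> n p
        \<le> c * real n powr (1 / q - 1 / p)) sequentially"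
    using O by (elim landau_o.bigE) (auto simp: weight_norm_def)
  let ?h = "\<lambda>n \<omega>. min (\<bar>\<epsilon> 0 \<omega>\<bar> powr p) (c powr q * real n powr (1 - q / p) * \<bar>\<epsilon> 0 \<omega>\<bar> powr q)"
  let ?P = "\<lambda>n. prob {\<omega> \<in> space M. \<bar>inverse (weight_norm \<psi> n p) * partial_sum \<psi> \<epsilon> n \<omega>\<bar> > \<delta>}"
  have exponent: "(c * real n powr (1 / q - 1 / p)) powr q = c powr q * real n powr (1 - q / p)" for n
  proof -
    have "(1 / q - 1 / p) * q = 1 - q / p"
      using p q by (simp add: field_simps)
    then show ?thesis using c by (simp add: powr_mult powr_powr)
  qed
  have "eventually (\<lambda>n. ?P n \<le> (4 / \<delta>\<^sup>2 + 4 / \<delta>) * expectation (?h n)) sequentially"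
    using ev
  proof eventually_elim
    case (elim n)
    show ?case
      using normalized_partial_sum_tail[OF assms(8,9) q \<delta> elim] by (simp only: exponent)
  qed
  then have "eventually (\<lambda>n. ?P (Suc n) \<le> (4 / \<delta>\<^sup>2 + 4 / \<delta>) * expectation (?h (Suc n))) sequentially"
    by (rule eventually_sequentially_Suc[THEN iffD2])
  then have "eventually (\<lambda>n. norm (inverse (real (Suc n)) * ?P (Suc n)) \<le>
      (4 / \<delta>\<^sup>2 + 4 / \<delta>) * (inverse (real (Suc n)) * expectation (?h (Suc n)))) sequentially"
  proof eventually_elim
    case (elim n)
    have "inverse (real (Suc n)) * ?P (Suc n)
        \<le> inverse (real (Suc n)) * ((4 / \<delta>\<^sup>2 + 4 / \<delta>) * expectation (?h (Suc n)))"
      by (intro mult_left_mono elim) simp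
    then show ?case by (simp add: abs_mult mult.left_commute)
  qed
  moreover have "summable (\<lambda>n. (4 / \<delta>\<^sup>2 + 4 / \<delta>) * (inverse (real (Suc n)) * expectation (?h (Suc n))))"
    using q by (intro summable_mult summable_expected_min) auto
  ultimately show "summable (\<lambda>n. inverse (real (Suc n)) * ?P (Suc n))"
    by (rule summable_comparison_test_ev)
qed

end
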